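(* For a given positive integer $n$, there exists an $n\times n\times n$ alternating sign hypermatrix $A$ such that in the $n\times n$ matrix $L(A)$: (i) if $n$ is odd, the integer $\frac{n+1}{2}$ occurs as an entry $\frac{n^2+4n-19}{2}$ times; (ii) if $n$ is even, the integer $\frac{n}{2}$ occurs as an entry $\frac{n^2+4n-20}{2}$ times.
   Context: An alternating sign hypermatrix (ASHM) is an $n\times n\times n$ hypermatrix $A=[a_{ijk}]$ with entries in $\{0,1,-1\}$ such that in every row line $[a_{ijk}: i=1,\dots,n]$ (fixed $j,k$), column line $[a_{ijk}: j=1,\dots,n]$ (fixed $i,k$) and vertical line $[a_{ijk}: k=1,\dots,n]$ (fixed $i,j$) the non-zero entries alternate in sign, starting and ending with $+1$. The $k$-th plane of $A$ is $P_k(A)=[a_{ijk}]_{i,j=1}^n$, and the ASHL of $A$ is the $n\times n$ matrix $L(A)=\sum_{k=1}^n k\,P_k(A)$.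
   Formalization: The formal theorem assumes n ≥ 4; the claim fails for n = 1, 2 (the required counts −7 and −4 are negative) and for n = 3 (the count should be 1, but the integer 2 occurs 3 or 5 times in every 3×3 L(A)). *)

theory Defs
  imports Main
begin

definition alt_sign_line :: "int list \<Rightarrow> bool" where
  "alt_sign_line xs \<longleftrightarrow>
     (let ys = filter (\<lambda>x. x \<noteq> 0) xs in
        ys \<noteq> [] \<and> hd ys = 1 \<and> last ys = 1 \<and>
        (\<forall>i. Suc i < length ys \<longrightarrow> ys ! Suc i = - (ys ! i)))"

definition ASHM :: "nat \<Rightarrow> (nat \<Rightarrow> nat \<Rightarrow> nat \<Rightarrow> int) \<Rightarrow> bool" where
  "ASHM n A \<longleftrightarrow>
     (\<forall>i\<in>{1..n}. \<forall>j\<in>{1..n}. \<forall>k\<in>{1..n}. A i j k \<in> {0, 1, -1}) \<and>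
     (\<forall>j\<in>{1..n}. \<forall>k\<in>{1..n}. alt_sign_line (map (\<lambda>i. A i j k) [1..<n+1])) \<and>
     (\<forall>i\<in>{1..n}. \<forall>k\<in>{1..n}. alt_sign_line (map (\<lambda>j. A i j k) [1..<n+1])) \<and>
     (\<forall>i\<in>{1..n}. \<forall>j\<in>{1..n}. alt_sign_line (map (\<lambda>k. A i j k) [1..<n+1]))"

definition plane :: "(nat \<Rightarrow> nat \<Rightarrow> nat \<Rightarrow> int) \<Rightarrow> nat \<Rightarrow> nat \<Rightarrow> nat \<Rightarrow> int" where
  "plane A k = (\<lambda>i j. A i j k)"

definition ASHL :: "nat \<Rightarrow> (nat \<Rightarrow> nat \<Rightarrow> nat \<Rightarrow> int) \<Rightarrow> nat \<Rightarrow> nat \<Rightarrow> int" where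
  "ASHL n A = (\<lambda>i j. \<Sum>k=1..n. int k * plane A k i j)"

definition occurrences :: "nat \<Rightarrow> (nat \<Rightarrow> nat \<Rightarrow> int) \<Rightarrow> int \<Rightarrow> nat" where
  "occurrences n M c = card {(i, j). i \<in> {1..n} \<and> j \<in> {1..n} \<and> M i j = c}"

end

theory Submission
  imports Defs
begin

text \<open>
  Let \<open>h\<close> be the target entry, so that \<open>P\<^sub>h\<close> is (nearly) the middle plane. The planes \<open>P\<^sub>k\<close> are
  filled with concentric diamonds of alternating signs that shrink as \<open>d = \<bar>k - h\<bar>\<close> grows: an
  octahedron. A vertical line through the octahedron is symmetric about height \<open>h\<close>, hence
  contributes the entry \<open>h\<close>, and this already accounts for about half of the \<open>n\<^sup>2\<close> positions.

  What is left of plane \<open>k\<close> are the rows and columns at distance at most \<open>d\<close> from the boundary,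
  meeting in the four triangular corners. There each vertical line is either a single \<open>+1\<close> or a
  pattern \<open>+1, -1, +1\<close> at heights \<open>h + a < h + b < h + c\<close>; the latter gives the entry \<open>h\<close>
  again when \<open>a - b + c = 0\<close>. The fillings of the corners are constant along antidiagonals away
  from the two outer edges, and the antidiagonals next to the octahedron supply the remaining
  \<open>2n - 10\<close> occurrences. The order \<open>n = 4\<close>, too small for this, is served by a tetrahedron of
  alternating signs.
\<close>

section \<open>Alternating lines as prefix sums\<close>

text \<open>The function \<open>g\<close> lists the prefix sums of \<open>f 1, \<dots>, f m\<close>, and \<open>t\<close> is the total.\<close>

definition ballot :: "(int \<Rightarrow> int) \<Rightarrow> int \<Rightarrow> int \<Rightarrow> bool" where
  "ballot f m t \<longleftrightarrow> (\<exists>g. g 0 = 0 \<and> g m = t \<and> (\<forall>q\<in>{0..m}. g q = 0 \<or> g q = 1) \<and>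
     (\<forall>q\<in>{1..m}. f q = g q - g (q - 1)))"

lemma ballotI:
  assumes "g 0 = 0" "g m = t" "\<And>q. 0 \<le> q \<Longrightarrow> q \<le> m \<Longrightarrow> g q = 0 \<or> g q = 1"
    and "\<And>q. 1 \<le> q \<Longrightarrow> q \<le> m \<Longrightarrow> f q = g q - g (q - 1)"
  shows "ballot f m t"
  unfolding ballot_def using assms by (intro exI[of _ g]) auto

lemma ballot_cong:
  assumes "\<And>q. 1 \<le> q \<Longrightarrow> q \<le> m \<Longrightarrow> f q = f' q"
  shows "ballot f m t = ballot f' m t"
  unfolding ballot_def using assms by (intro iff_exI conj_cong ball_cong refl) auto

lemma ballot_range:
  assumes "ballot f m t" "1 \<le> q" "q \<le> m"
  shows "f q \<in> {0, 1, -1}"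
proof -
  obtain g where g: "\<forall>q\<in>{0..m}. g q = 0 \<or> g q = 1" "\<forall>q\<in>{1..m}. f q = g q - g (q - 1)"
    using assms(1) unfolding ballot_def by blast
  from g(1) assms have "g q = 0 \<or> g q = 1" "g (q - 1) = 0 \<or> g (q - 1) = 1"
    by auto
  moreover have "f q = g q - g (q - 1)" using g(2) assms by auto
  ultimately show ?thesis by auto
qed

lemma ballot_sum:
  assumes "ballot f (int n) t"
  shows "(\<Sum>q\<in>{1..int n}. f q) = t"
proof -
  obtain g where g: "g 0 = 0" "g (int n) = t" "\<forall>q\<in>{1..int n}. f q = g q - g (q - 1)"
    using assms(1) unfolding ballot_def by blast
  have "m \<le> n \<Longrightarrow> (\<Sum>q\<in>{1..int m}. f q) = g (int m)" for m
  proof (induction m)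
    case (Suc m)
    have "{1..int (Suc m)} = insert (int (Suc m)) {1..int m}" by auto
    moreover have "f (int (Suc m)) = g (int (Suc m)) - g (int m)"
      using g(3) Suc.prems by auto
    ultimately show ?case using Suc by simp
  qed (simp add: g)
  then show ?thesis using g by simp
qed

text \<open>Since the total is 1, the suffix sums \<open>1 - g (m - q)\<close> are again 0 or 1, and
  they are the prefix sums of the reversed line.\<close>

lemma ballot_reverse:
  assumes "ballot f m 1"
  shows "ballot (\<lambda>q. f (m + 1 - q)) m 1"
proof -
  obtain g where g: "g 0 = 0" "g m = 1" "\<forall>q\<in>{0..m}. g q = 0 \<or> g q = 1"
     "\<forall>q\<in>{1..m}. f q = g q - g (q - 1)"
    using assms(1) unfolding ballot_def by blast
  show ?thesis
  proof (rule ballotI[of "\<lambda>q. 1 - g (m - q)"])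
    fix q assume "0 \<le> q" "q \<le> m"
    then have "g (m - q) = 0 \<or> g (m - q) = 1" using g(3) by auto
    then show "1 - g (m - q) = 0 \<or> 1 - g (m - q) = 1" by auto
  next
    fix q assume "1 \<le> q" "q \<le> m"
    then have "f (m + 1 - q) = g (m + 1 - q) - g (m + 1 - q - 1)" using g(4) by auto
    then show "f (m + 1 - q) = 1 - g (m - q) - (1 - g (m - (q - 1)))"
      by (simp add: algebra_simps)
  qed (use g in auto)
qed

text \<open>With prefix sums confined to 0 and 1, a nonzero entry must be +1 at sum 0 and -1 at sum
  1, so the signs alternate starting with +1; the total 1 makes the last one +1.\<close>

lemma alt_sign_line_ballot:
  assumes "ballot f (int n) 1"
  shows "alt_sign_line (map (\<lambda>q. f (int q)) [1..<n+1])"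
proof -
  obtain g where g: "g 0 = 0" "g (int n) = 1" "\<forall>q\<in>{0..int n}. g q = 0 \<or> g q = 1"
     "\<forall>q\<in>{1..int n}. f q = g q - g (q - 1)"
    using assms(1) unfolding ballot_def by blast
  define alt where "alt = (\<lambda>ys::int list. \<forall>i. Suc i < length ys \<longrightarrow> ys ! Suc i = - (ys ! i))"
  define Y where "Y = (\<lambda>m. filter (\<lambda>x. x \<noteq> 0) (map (\<lambda>q. f (int q)) [1..<m+1]))"
  have snoc: "alt (ys @ [y])" if "alt ys" "ys \<noteq> [] \<Longrightarrow> y = - last ys" for ys y
    unfolding alt_def
  proof (intro allI impI)
    fix i assume i: "Suc i < length (ys @ [y])"
    show "(ys @ [y]) ! Suc i = - ((ys @ [y]) ! i)"
    proof (cases "Suc i < length ys")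
      case True
      then show ?thesis using that(1) by (simp add: alt_def nth_append)
    next
      case False
      then have *: "Suc i = length ys" using i by simp
      then have "ys \<noteq> []" by auto
      then have "last ys = ys ! i" using * by (simp add: last_conv_nth flip: *)
      then show ?thesis using * that(2) \<open>ys \<noteq> []\<close> by (simp add: nth_append)
    qed
  qed
  \<comment> \<open>The prefix sum remembers the last nonzero entry: +1 if the sum is 1, -1 if it is
    0.\<close>
  have inv: "m \<le> n \<Longrightarrow> alt (Y m) \<and> (Y m = [] \<longrightarrow> g (int m) = 0) \<and>
      (Y m \<noteq> [] \<longrightarrow> hd (Y m) = 1 \<and> last (Y m) = 2 * g (int m) - 1)" for m
  proof (induction m)
    case 0
    then show ?case by (simp add: Y_def alt_def g)
  next
    case (Suc m)
    have f: "f (int (Suc m)) = g (int (Suc m)) - g (int m)"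
      using g(4) Suc.prems by auto
    have r: "g (int (Suc m)) = 0 \<or> g (int (Suc m)) = 1" "g (int m) = 0 \<or> g (int m) = 1"
      using g(3) Suc.prems by auto
    have Y: "Y (Suc m) = Y m @ (if f (int (Suc m)) = 0 then [] else [f (int (Suc m))])"
      by (simp add: Y_def)
    have IH: "alt (Y m)" "Y m = [] \<Longrightarrow> g (int m) = 0"
      "Y m \<noteq> [] \<Longrightarrow> hd (Y m) = 1" "Y m \<noteq> [] \<Longrightarrow> last (Y m) = 2 * g (int m) - 1"
      using Suc by auto
    show ?case
    proof (cases "f (int (Suc m)) = 0")
      case True
      then show ?thesis using IH f Y by auto
    next
      case False
      then have *: "Y m \<noteq> [] \<Longrightarrow> f (int (Suc m)) = - last (Y m)" "f (int (Suc m)) = 2 * g (int (Suc m)) - 1"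
        using IH(4) f r by auto
      then show ?thesis using False snoc[OF IH(1)] IH(2,3) f r Y
        by (cases "Y m = []") auto
    qed
  qed
  have "alt (Y n)" "Y n \<noteq> []" "hd (Y n) = 1" "last (Y n) = 1"
    using inv[of n] g by auto
  then show ?thesis by (simp add: alt_sign_line_def Let_def Y_def alt_def)
qed

text \<open>A position \<open>a\<close> or \<open>b\<close> beyond \<open>m\<close> stands for an
  absent sign, so this covers the empty line, a single +1 and the pair +1, -1.\<close>

lemma ballot_pair:
  assumes "1 \<le> a" "a < b" "0 \<le> m"
    and "\<And>q. 1 \<le> q \<Longrightarrow> q \<le> m \<Longrightarrow> f q = of_bool (q = a) - of_bool (q = b)"
    and "t = of_bool (a \<le> m \<and> m < b)"
  shows "ballot f m t"
  by (rule ballotI[of "\<lambda>q. of_bool (a \<le> q \<and> q < b)"]) (use assms in auto)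

text \<open>The triple \<open>(a, b, c)\<close> encodes the vertical pattern \<open>+1, -1, +1\<close> at these heights relative to
  \<open>h\<close>; a single \<open>+1\<close> is encoded by \<open>a = b = c\<close>.\<close>

fun tri :: "int \<times> int \<times> int \<Rightarrow> int \<Rightarrow> int" where
  "tri (a, b, c) l = of_bool (l = a) - of_bool (l = b) + of_bool (l = c)"

fun alt_sum :: "int \<times> int \<times> int \<Rightarrow> int" where
  "alt_sum (a, b, c) = a - b + c"

fun wf_tri :: "int \<Rightarrow> int \<Rightarrow> int \<times> int \<times> int \<Rightarrow> bool" where
  "wf_tri x y (a, b, c) \<longleftrightarrow> x \<le> a \<and> c \<le> y \<and> (a < b \<and> b < c \<or> a = b \<and> b = c)"

lemma ballot_tri:
  assumes "wf_tri (1 - h) (m - h) p"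
  shows "ballot (\<lambda>k. tri p (k - h)) m 1"
proof -
  obtain a b c where p: "p = (a, b, c)" by (cases p)
  show ?thesis
    by (rule ballotI[of "\<lambda>q. of_bool (a + h \<le> q) - of_bool (b + h \<le> q) + of_bool (c + h \<le> q)"])
      (use assms p in auto)
qed

text \<open>The bracket \<open>b \<le> q \<or> a \<le> q \<and> even (q - a)\<close> is the prefix
  sum of an alternating block on \<open>a..b\<close>: 1 at even distance from \<open>a\<close>, then
  constantly 1.\<close>

lemma checkerboard_diff:
  fixes a b q :: int
  assumes "a \<le> b" "even (b - a)"
  shows "of_bool (b \<le> q \<or> a \<le> q \<and> even (q - a)) -
      of_bool (b \<le> q - 1 \<or> a \<le> q - 1 \<and> even (q - 1 - a)) =
    (if a \<le> q \<and> q \<le> b then if even (q - a) then 1 else -1 else (0 :: int))"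
proof -
  have par: "even (q - 1 - a) \<longleftrightarrow> odd (q - a)" by presburger
  consider "q < a" | "q = a" | "a < q" "q < b" | "a < q" "q = b" | "q = b + 1" | "b + 1 < q"
    by linarith
  then show ?thesis unfolding par using assms by cases simp_all
qed

lemma ballot_checkerboard:
  assumes "1 \<le> a" "a \<le> b" "b \<le> m" "even (b - a)"
    and "\<And>q. 1 \<le> q \<Longrightarrow> q \<le> m \<Longrightarrow>
      f q = (if a \<le> q \<and> q \<le> b then if even (q - a) then 1 else -1 else 0)"
  shows "ballot f m 1"
  by (rule ballotI[of "\<lambda>q. of_bool (b \<le> q \<or> a \<le> q \<and> even (q - a))"])
    (use assms(1-4) in \<open>auto simp: assms(5) checkerboard_diff\<close>)

section \<open>Height-weighted sums along vertical lines\<close>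

lemma sum_ident_of_bool:
  assumes "x \<le> c" "c \<le> (y::int)"
  shows "(\<Sum>k\<in>{x..y}. k * of_bool (k = c)) = c"
  using assms by (simp add: of_bool_def if_distrib cong: if_cong)

lemma sum_tri:
  assumes "wf_tri (1 - h) (m - h) p"
  shows "(\<Sum>k\<in>{1..m}. k * tri p (k - h)) = h + alt_sum p"
proof -
  obtain a b c where p: "p = (a, b, c)" by (cases p)
  have "(\<Sum>k\<in>{1..m}. k * tri p (k - h)) = (\<Sum>k\<in>{1..m}. k * of_bool (k = a + h))
      - (\<Sum>k\<in>{1..m}. k * of_bool (k = b + h)) + (\<Sum>k\<in>{1..m}. k * of_bool (k = c + h))"
    unfolding p tri.simps sum_subtractf[symmetric] sum.distrib[symmetric]
    by (intro sum.cong refl) (auto simp: algebra_simps of_bool_def)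
  also have "\<dots> = h + alt_sum p"
    using assms p by (subst (1 2 3) sum_ident_of_bool) auto
  finally show ?thesis .
qed

text \<open>Reflecting k to 2h - k turns the weighted sum S into 2h - S. Symmetry and vanishing
  below 1 confine the support to 1..2h-1, which lies inside 1..m.\<close>

lemma sum_symmetric:
  fixes f :: "int \<Rightarrow> int"
  assumes "\<And>k. f (2 * h - k) = f k" "\<And>k. k < 1 \<Longrightarrow> f k = 0" "2 * h \<le> m + 1"
    and one: "(\<Sum>k\<in>{1..m}. f k) = 1"
  shows "(\<Sum>k\<in>{1..m}. k * f k) = h"
proof -
  have sub: "(\<Sum>k\<in>{1..m}. u k) = (\<Sum>k\<in>{1..2*h-1}. u k)"
    if "\<And>k. 2 * h \<le> k \<Longrightarrow> u k = 0" for u :: "int \<Rightarrow> int"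
    using that assms(3) by (intro sum.mono_neutral_right) auto
  have z: "f k = 0" if "2 * h \<le> k" for k
    using assms(1)[of k] assms(2)[of "2*h-k"] that by simp
  have "(\<Sum>k\<in>{1..2*h-1}. k * f k) = (\<Sum>k\<in>{1..2*h-1}. (2 * h - k) * f k)"
    by (rule sum.reindex_bij_witness[of _ "\<lambda>k. 2*h-k" "\<lambda>k. 2*h-k"]) (auto simp: assms(1))
  also have "\<dots> = 2 * h * (\<Sum>k\<in>{1..2*h-1}. f k) - (\<Sum>k\<in>{1..2*h-1}. k * f k)"
    by (simp add: algebra_simps sum_subtractf sum_distrib_left)
  finally have "2 * (\<Sum>k\<in>{1..2*h-1}. k * f k) = 2 * h * (\<Sum>k\<in>{1..2*h-1}. f k)" by simp
  moreover have "(\<Sum>k\<in>{1..2*h-1}. f k) = 1" using sub[of f] z one by simp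
  ultimately show ?thesis using sub[of "\<lambda>k. k * f k"] z by simp
qed

lemma sum_int_atLeastAtMost: "(\<Sum>k=1..n. u (int k)) = (\<Sum>k\<in>{1..int n}. u k)"
  by (rule sum.reindex_bij_witness[of _ nat int]) auto

section \<open>The octahedron with filled corners\<close>

text \<open>Row \<open>i\<close> meets the octahedron in plane \<open>h + l\<close> only if \<open>\<bar>l\<bar> < i\<close>. So for \<open>i \<le> \<bar>l\<bar>\<close> exactly one
  of its two corner segments must sum to 1, and otherwise none. Both segments are read from the
  outside inwards: \<open>tau\<close> fills the top left corner and \<open>mu\<close> the top right one with its columns
  reversed. The bottom corners are obtained by a half turn.\<close>

locale corner_filling =
  fixes h w :: int and tau mu :: "int \<Rightarrow> int \<Rightarrow> int \<times> int \<times> int"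
  assumes h_pos: "1 \<le> h" and w_cases: "w = h \<or> w = h + 1"
    and tau_sym: "tau i j = tau j i" and mu_sym: "mu i j = mu j i"
    and tau_wf: "1 \<le> i \<Longrightarrow> 1 \<le> j \<Longrightarrow> i + j \<le> h \<Longrightarrow> wf_tri (1 - h) (w - 1) (tau i j)"
    and mu_wf: "1 \<le> i \<Longrightarrow> 1 \<le> j \<Longrightarrow> i + j \<le> w \<Longrightarrow> wf_tri (1 - h) (w - 1) (mu i j)"
    and corner_rows: "1 \<le> i \<Longrightarrow> i \<le> h \<Longrightarrow> 1 - h \<le> l \<Longrightarrow> l \<le> w - 1 \<Longrightarrow>
      \<exists>t u. ballot (\<lambda>q. tri (tau i q) l) (h - i) t \<and> ballot (\<lambda>q. tri (mu i q) l) (w - i) u \<and>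
        t + u = of_bool (i \<le> \<bar>l\<bar>)"
begin

text \<open>Odd order for \<open>w = h\<close>, even order for \<open>w = h + 1\<close>; levels
  relative to \<open>h\<close> run from \<open>1 - h\<close> to \<open>w - 1\<close>.\<close>

definition n :: int where "n = h + w - 1"

text \<open>The first branch is the octahedron: in each plane a diamond, slightly elongated along
  the main diagonal when \<open>w = h + 1\<close>, with +1 on its boundary. Then follow the top
  left, bottom right, top right and bottom left corners.\<close>

definition F :: "int \<Rightarrow> int \<Rightarrow> int \<Rightarrow> int" where
  "F i j k =
    (if h + 1 + \<bar>k - h\<bar> \<le> i + j \<and> \<bar>i - j\<bar> \<le> h - 1 - \<bar>k - h\<bar> \<and> i + j \<le> n + w - \<bar>k - h\<bar>
     then if even (i + j + h + 1 + \<bar>k - h\<bar>) then 1 else -1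
     else if i + j \<le> h then tri (tau i j) (k - h)
     else if n + w < i + j then tri (tau (n + 1 - i) (n + 1 - j)) (k - h)
     else if h \<le> j - i then tri (mu i (n + 1 - j)) (k - h)
     else if h \<le> i - j then tri (mu (n + 1 - i) j) (k - h)
     else 0)"

section \<open>Symmetries of \<open>F\<close>\<close>

lemma F_transpose: "F i j k = F j i k"
proof -
  have eqs: "tau j i = tau i j" "tau (n + 1 - j) (n + 1 - i) = tau (n + 1 - i) (n + 1 - j)"
    "mu j (n + 1 - i) = mu (n + 1 - i) j" "mu (n + 1 - j) i = mu i (n + 1 - j)"
    "j + i = i + j" "\<bar>j - i\<bar> = \<bar>i - j\<bar>"
    by (rule tau_sym mu_sym add.commute abs_minus_commute)+
  have "\<not> (h \<le> j - i \<and> h \<le> i - j)" using h_pos by linarith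
  then show ?thesis
    unfolding F_def[of i j k] F_def[of j i k] eqs
    by (cases "h \<le> j - i"; cases "h \<le> i - j") (simp_all only: simp_thms if_True if_False)
qed

text \<open>The half turn exchanges opposite corners and fixes the octahedron; it sends rows below
  \<open>h\<close> to rows \<open>i \<le> h\<close>.\<close>

lemma F_rotate: "F (n + 1 - i) (n + 1 - j) k = F i j k"
proof -
  define d where "d = \<bar>k - h\<bar>"
  define s where "s = i + j"
  have eqs: "n + 1 - i + (n + 1 - j) = n + w + h + 1 - s" "n + 1 - i - (n + 1 - j) = j - i"
    "n + 1 - j - (n + 1 - i) = i - j" "n + 1 - (n + 1 - x) = x" for x
    by (simp_all add: n_def s_def)
  have par: "even (n + w + h + 1 - s + h + 1 + d) \<longleftrightarrow> even (s + h + 1 + d)"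
    unfolding n_def by presburger
  have region: "h + 1 + d \<le> n + w + h + 1 - s \<and> \<bar>j - i\<bar> \<le> h - 1 - d \<and> n + w + h + 1 - s \<le> n + w - d
      \<longleftrightarrow> h + 1 + d \<le> s \<and> \<bar>i - j\<bar> \<le> h - 1 - d \<and> s \<le> n + w - d"
    by linarith
  have corners: "n + w + h + 1 - s \<le> h \<longleftrightarrow> n + w < s" "n + w < n + w + h + 1 - s \<longleftrightarrow> s \<le> h"
    by linarith+
  have "\<not> (s \<le> h \<and> n + w < s)" "\<not> (h \<le> j - i \<and> h \<le> i - j)"
    using h_pos w_cases unfolding n_def by linarith+
  then show ?thesis
    unfolding F_def eqs d_def[symmetric] s_def[symmetric] par region corners
    by (cases "h \<le> j - i"; cases "h \<le> i - j"; cases "s \<le> h"; cases "n + w < s")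
      (simp_all only: simp_thms if_True if_False)
qed

section \<open>Rows and vertical lines of \<open>F\<close>\<close>

lemma F_left:
  assumes "1 \<le> i" "i \<le> h" "j \<le> h - i"
  shows "F i j k = tri (tau i j) (k - h)"
proof -
  have "\<not> h + 1 + \<bar>k - h\<bar> \<le> i + j" "i + j \<le> h" using assms by linarith+
  then show ?thesis by (simp only: F_def simp_thms if_True if_False)
qed

lemma F_right:
  assumes "1 \<le> i" "i \<le> h" "h + i \<le> j" "j \<le> n"
  shows "F i j k = tri (mu i (n + 1 - j)) (k - h)"
proof -
  have "\<not> \<bar>i - j\<bar> \<le> h - 1 - \<bar>k - h\<bar>" "\<not> i + j \<le> h" "\<not> n + w < i + j" "h \<le> j - i"
    using assms w_cases unfolding n_def by linarith+
  then show ?thesis by (simp add: F_def)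
qed

text \<open>In the top half the two lower edges of the diamond are implied by the two upper ones, so
  the row meets it in an interval.\<close>

lemma F_middle:
  assumes "1 \<le> i" "i \<le> h" "h - i < j" "j < h + i" "1 \<le> j"
  shows "F i j k = (if h + 1 + \<bar>k - h\<bar> - i \<le> j \<and> j \<le> h - 1 - \<bar>k - h\<bar> + i
     then if even (i + j + h + 1 + \<bar>k - h\<bar>) then 1 else -1 else 0)"
proof -
  define d where "d = \<bar>k - h\<bar>"
  have d: "0 \<le> d" by (simp add: d_def)
  have "(h + 1 + d \<le> i + j \<and> \<bar>i - j\<bar> \<le> h - 1 - d \<and> i + j \<le> n + w - d) \<longleftrightarrow>
      (h + 1 + d - i \<le> j \<and> j \<le> h - 1 - d + i)"
    using assms w_cases d unfolding n_def abs_le_iff by linarith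
  moreover have "\<not> i + j \<le> h" "\<not> n + w < i + j" "\<not> h \<le> j - i" "\<not> h \<le> i - j"
    using assms w_cases unfolding n_def by linarith+
  ultimately show ?thesis unfolding F_def d_def[symmetric] by simp
qed

text \<open>The row is glued from the left segment, the octahedron and the right segment. If
  \<open>\<bar>k - h\<bar> < i\<close>, both segments have total 0 and the octahedron contributes 1;
  otherwise the row misses the octahedron and exactly one segment contributes 1.\<close>

lemma ballot_row_top:
  assumes i: "1 \<le> i" "i \<le> h" and k: "1 \<le> k" "k \<le> n"
  shows "ballot (\<lambda>j. F i j k) n 1"
proof -
  define d where "d = \<bar>k - h\<bar>"
  define a where "a = h + 1 + d - i"
  define b where "b = h - 1 - d + i"
  have d: "0 \<le> d" by (simp add: d_def)
  obtain t u where tu: "ballot (\<lambda>q. tri (tau i q) (k - h)) (h - i) t"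
      "ballot (\<lambda>q. tri (mu i q) (k - h)) (w - i) u" "t + u = of_bool (i \<le> d)"
    using corner_rows[of i "k - h"] i k unfolding d_def n_def by auto
  obtain x where x: "x 0 = 0" "x (h - i) = t" "\<And>q. 0 \<le> q \<Longrightarrow> q \<le> h - i \<Longrightarrow> x q = 0 \<or> x q = 1"
      "\<And>q. 1 \<le> q \<Longrightarrow> q \<le> h - i \<Longrightarrow> tri (tau i q) (k - h) = x q - x (q - 1)"
    using tu(1) unfolding ballot_def by auto
  obtain y where y: "y 0 = 0" "y (w - i) = u" "\<And>q. 0 \<le> q \<Longrightarrow> q \<le> w - i \<Longrightarrow> y q = 0 \<or> y q = 1"
      "\<And>q. 1 \<le> q \<Longrightarrow> q \<le> w - i \<Longrightarrow> tri (mu i q) (k - h) = y q - y (q - 1)"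
    using tu(2) unfolding ballot_def by auto
  have t01: "t = 0 \<or> t = 1" using x(2) x(3)[of "h - i"] i by auto
  have u01: "u = 0 \<or> u = 1" using y(2) y(3)[of "w - i"] i w_cases by auto
  have tu0: "t = 0 \<and> u = 0" if "d < i" using tu(3) t01 u01 that by auto
  have tu1: "u = 1 - t" if "i \<le> d" using tu(3) that by auto
  \<comment> \<open>Prefix sum of the octahedral part, identically 0 when the row misses the
    octahedron.\<close>
  define c where "c = (\<lambda>j. of_bool (d < i \<and> (b \<le> j \<or> a \<le> j \<and> even (j - a))) :: int)"
  have c01: "c j = 0 \<or> c j = 1" "t + c j = 0 \<or> t + c j = 1" for j
    using t01 tu0 by (auto simp: c_def)
  have c_low: "c j = 0" if "j \<le> h - i" for j
    using that d i by (auto simp: c_def a_def b_def)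
  have c_high: "t + c j = 1 - u" if "h + i - 1 \<le> j" for j
    using that d i tu0 tu1 by (auto simp: c_def a_def b_def)
  have c_diff: "c j - c (j - 1) = (if a \<le> j \<and> j \<le> b then if even (j - a) then 1 else -1 else 0)" for j
  proof (cases "d < i")
    case False
    then show ?thesis by (simp add: c_def a_def b_def)
  next
    case True
    then have "a \<le> b" "even (b - a)" by (simp_all add: a_def b_def)
    from checkerboard_diff[OF this, of j] show ?thesis using True by (simp only: c_def simp_thms)
  qed
  have par: "even (j - a) \<longleftrightarrow> even (i + j + h + 1 + d)" for j
    unfolding a_def by presburger
  \<comment> \<open>The right segment is read inwards, so its prefix sums enter as suffix sums.
    Neighbouring pieces agree at \<open>h - i\<close> and \<open>h + i - 1\<close>.\<close>
  define g where "g = (\<lambda>j. if j \<le> h - i then x j else if j < h + i then t + c j else 1 - y (n - j))"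
  have g_mid: "g j = t + c j" if "h - i \<le> j" "j \<le> h + i - 1" for j
    using that x(2) c_low[of "h - i"] by (auto simp: g_def)
  have g_high: "g j = 1 - y (n - j)" if "h + i - 1 \<le> j" for j
  proof (cases "j = h + i - 1")
    case True
    then have "n - j = w - i" by (simp add: n_def)
    then have "y (n - j) = u" using y(2) by simp
    then show ?thesis using True g_mid[of j] c_high[of j] i by simp
  qed (use that i in \<open>auto simp: g_def\<close>)
  show ?thesis
  proof (rule ballotI[of g])
    show "g 0 = 0" using x(1) i by (simp add: g_def)
    show "g n = 1" using g_high[of n] y(1) i w_cases by (auto simp: n_def)
    fix j
    show "g j = 0 \<or> g j = 1" if "0 \<le> j" "j \<le> n"
    proof -
      consider "j \<le> h - i" | "h - i \<le> j" "j \<le> h + i - 1" | "h + i - 1 \<le> j" by linarith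
      then show ?thesis
      proof cases
        case 1
        then show ?thesis using x(3) that by (simp add: g_def)
      next
        case 2
        then show ?thesis using g_mid c01 by simp
      next
        case 3
        then show ?thesis using g_high[OF 3] y(3)[of "n - j"] that by (auto simp: n_def)
      qed
    qed
    show "F i j k = g j - g (j - 1)" if j: "1 \<le> j" "j \<le> n"
    proof -
      consider "j \<le> h - i" | "h - i < j" "j < h + i" | "h + i \<le> j" by linarith
      then show ?thesis
      proof cases
        case 1
        then show ?thesis using F_left[OF i 1] x(4)[of j] j by (simp add: g_def)
      next
        case 2
        then have "g j - g (j - 1) = c j - c (j - 1)" using g_mid[of j] g_mid[of "j - 1"] by simp
        also have "\<dots> = F i j k"
          unfolding c_diff F_middle[OF i 2 j(1)] par by (simp add: a_def b_def d_def)
        finally show ?thesis ..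
      next
        case 3
        have "tri (mu i (n + 1 - j)) (k - h) = y (n + 1 - j) - y (n + 1 - j - 1)"
          using 3 j by (intro y(4)) (auto simp: n_def)
        moreover have "y (n + 1 - j) = y (n - (j - 1))" "y (n + 1 - j - 1) = y (n - j)"
          by (rule arg_cong[of _ _ y], simp)+
        ultimately show ?thesis
          using F_right[OF i 3 j(2)] g_high[of j] g_high[of "j - 1"] 3 by simp
      qed
    qed
  qed
qed

lemma ballot_row:
  assumes i: "1 \<le> i" "i \<le> n" and k: "1 \<le> k" "k \<le> n"
  shows "ballot (\<lambda>j. F i j k) n 1"
proof (cases "i \<le> h")
  case True
  then show ?thesis using ballot_row_top assms by simp
next
  case False
  then have "ballot (\<lambda>j. F (n + 1 - i) j k) n 1"
    using ballot_row_top[of "n + 1 - i" k] assms w_cases by (auto simp: n_def)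
  then have "ballot (\<lambda>j. F (n + 1 - i) (n + 1 - j) k) n 1"
    by (rule ballot_reverse)
  then show ?thesis by (simp add: F_rotate)
qed

lemma ballot_vertical_top:
  assumes i: "1 \<le> i" "i \<le> h" and j: "1 \<le> j" "j \<le> n"
  shows "ballot (F i j) n 1"
proof -
  have nh: "n - h = w - 1" by (simp add: n_def)
  consider "j \<le> h - i" | "h - i < j" "j < h + i" | "h + i \<le> j" by linarith
  then show ?thesis
  proof cases
    case 1
    then show ?thesis using ballot_tri[of h n "tau i j"] tau_wf[of i j] i j
      by (simp add: F_left nh cong: ballot_cong)
  next
    case 2
    \<comment> \<open>\<open>D\<close> is the largest distance from \<open>h\<close> at which the
      line is still inside the octahedron; its parity puts +1 at both ends.\<close>
    define D where "D = min (i + j - h - 1) (h - 1 + i - j)"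
    have D: "0 \<le> D" "D \<le> h - 1" "even (D + i + j + h + 1)" using 2 i by (auto simp: D_def min_def)
    show ?thesis
    proof (rule ballot_checkerboard[of "h - D" "h + D"])
      fix k
      have par: "even (k - (h - D)) \<longleftrightarrow> even (i + j + h + 1 + \<bar>k - h\<bar>)"
        using D(3) by presburger
      show "F i j k = (if h - D \<le> k \<and> k \<le> h + D then if even (k - (h - D)) then 1 else -1 else 0)"
        unfolding F_middle[OF i 2 j(1)] par by (auto simp: D_def)
    qed (use D w_cases in \<open>auto simp: n_def\<close>)
  next
    case 3
    then show ?thesis using ballot_tri[of h n "mu i (n + 1 - j)"] mu_wf[of i "n + 1 - j"] i j
      by (simp add: F_right nh n_def cong: ballot_cong)
  qed
qed

lemma ballot_vertical:
  assumes i: "1 \<le> i" "i \<le> n" and j: "1 \<le> j" "j \<le> n"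
  shows "ballot (F i j) n 1"
proof (cases "i \<le> h")
  case True
  then show ?thesis using ballot_vertical_top assms by simp
next
  case False
  then have "ballot (F (n + 1 - i) (n + 1 - j)) n 1"
    using ballot_vertical_top[of "n + 1 - i" "n + 1 - j"] assms w_cases by (auto simp: n_def)
  then show ?thesis by (simp add: F_rotate[abs_def] cong: ballot_cong)
qed

section \<open>The hypermatrix, its ASHL and the count of \<open>h\<close>\<close>

definition A :: "nat \<Rightarrow> nat \<Rightarrow> nat \<Rightarrow> int" where
  "A i j k = F (int i) (int j) (int k)"

lemma ASHM_A:
  assumes N: "int N = n"
  shows "ASHM N A"
proof -
  have 1: "ballot (\<lambda>j. F (int i) j (int k)) (int N) 1"
    if "i \<in> {1..N}" "k \<in> {1..N}" for i k
    unfolding N using that by (intro ballot_row) (auto simp flip: N)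
  have 2: "ballot (F (int i) (int j)) (int N) 1"
    if "i \<in> {1..N}" "j \<in> {1..N}" for i j
    unfolding N using that by (intro ballot_vertical) (auto simp flip: N)
  have 3: "F (int i) (int j) (int k) \<in> {0, 1, -1}" if "i \<in> {1..N}" "j \<in> {1..N}" "k \<in> {1..N}" for i j k
    using ballot_range[OF 1, of i k "int j"] that by auto
  have 4: "alt_sign_line (map (\<lambda>j. F (int i) (int j) (int k)) [1..<N + 1])"
    if "i \<in> {1..N}" "k \<in> {1..N}" for i k
    using alt_sign_line_ballot[OF 1] that .
  have 5: "alt_sign_line (map (\<lambda>i. F (int i) (int j) (int k)) [1..<N + 1])"
    if "j \<in> {1..N}" "k \<in> {1..N}" for j k
    using 4[OF that] by (subst F_transpose)
  have 6: "alt_sign_line (map (\<lambda>k. F (int i) (int j) (int k)) [1..<N + 1])"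
    if "i \<in> {1..N}" "j \<in> {1..N}" for i j
    using alt_sign_line_ballot[OF 2] that .
  show ?thesis unfolding ASHM_def A_def using 3 4 5 6 by blast
qed

definition L :: "int \<Rightarrow> int \<Rightarrow> int" where
  "L i j = (\<Sum>k\<in>{1..n}. k * F i j k)"

lemma ASHL_A:
  assumes N: "int N = n"
  shows "ASHL N A i j = L (int i) (int j)"
  unfolding ASHL_def plane_def A_def L_def
  using sum_int_atLeastAtMost[of "\<lambda>k. k * F (int i) (int j) k" N] by (simp add: N)

lemma L_rotate: "L (n + 1 - i) (n + 1 - j) = L i j"
  by (simp add: L_def F_rotate)

lemma L_left:
  assumes i: "1 \<le> i" "i \<le> h" and j: "1 \<le> j" "j \<le> h - i"
  shows "L i j = h + alt_sum (tau i j)"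
  using sum_tri[of h n "tau i j"] tau_wf[of i j] i j by (simp add: L_def F_left n_def)

lemma L_right:
  assumes i: "1 \<le> i" "i \<le> h" and j: "h + i \<le> j" "j \<le> n"
  shows "L i j = h + alt_sum (mu i (n + 1 - j))"
  using sum_tri[of h n "mu i (n + 1 - j)"] mu_wf[of i "n + 1 - j"] i j
  by (simp add: L_def F_right n_def)

text \<open>Here \<open>F i j k\<close> depends on \<open>k\<close> only through
  \<open>\<bar>k - h\<bar>\<close> and has total 1, so its weighted sum is the centre.\<close>

lemma L_middle:
  assumes i: "1 \<le> i" "i \<le> h" and j: "h - i < j" "j < h + i"
  shows "L i j = h"
  unfolding L_def
proof (rule sum_symmetric)
  have j': "1 \<le> j" "j \<le> n" using assms w_cases by (auto simp: n_def)
  show "F i j (2 * h - k) = F i j k" for k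
    by (simp add: F_middle[OF i j j'(1)] abs_minus_commute[of h k])
  show "F i j k = 0" if "k < 1" for k
    using that i j by (simp add: F_middle[OF i j j'(1)])
  show "2 * h \<le> n + 1" using w_cases by (auto simp: n_def)
  have "0 \<le> n" using j' by simp
  then show "(\<Sum>k\<in>{1..n}. F i j k) = 1"
    using ballot_sum[of "F i j" "nat n" 1] ballot_vertical_top[OF i j'] by simp
qed

text \<open>The middle part of row \<open>i\<close> has \<open>2 * i - 1\<close> positions, all with
  entry \<open>h\<close>; a corner position has entry \<open>h\<close> exactly when its
  \<open>alt_sum\<close> vanishes.\<close>

definition hits :: "int \<Rightarrow> int" where
  "hits i = 2 * i - 1 + int (card {q \<in> {1..h - i}. alt_sum (tau i q) = 0})
     + int (card {q \<in> {1..w - i}. alt_sum (mu i q) = 0})"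

lemma card_row:
  assumes i: "1 \<le> i" "i \<le> h"
  shows "int (card {j \<in> {1..n}. L i j = h}) = hits i"
proof -
  let ?T = "{q \<in> {1..h - i}. alt_sum (tau i q) = 0}" and ?U = "{q \<in> {1..w - i}. alt_sum (mu i q) = 0}"
  have eq: "{j \<in> {1..n}. L i j = h} = ?T \<union> ({h - i + 1..h + i - 1} \<union> (\<lambda>q. n + 1 - q) ` ?U)"
    (is "?A = ?B")
  proof (intro set_eqI)
    fix j
    have img: "j \<in> (\<lambda>q. n + 1 - q) ` B \<longleftrightarrow> n + 1 - j \<in> B" for B
      by (auto intro: image_eqI[where x = "n + 1 - j"])
    consider "j \<le> h - i" | "h - i < j" "j < h + i" | "h + i \<le> j" by linarith
    then show "j \<in> ?A \<longleftrightarrow> j \<in> ?B"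
    proof cases
      case 1
      then show ?thesis using L_left[OF i, of j] i w_cases unfolding Un_iff img by (auto simp: n_def)
    next
      case 2
      then show ?thesis using L_middle[OF i 2] i w_cases unfolding Un_iff img by (auto simp: n_def)
    next
      case 3
      then show ?thesis using L_right[OF i 3] i w_cases unfolding Un_iff img by (auto simp: n_def)
    qed
  qed
  have fin: "finite ?T" "finite ((\<lambda>q. n + 1 - q) ` ?U)"
    by (auto intro!: finite_imageI finite_subset[of ?T "{1..h - i}"] finite_subset[of ?U "{1..w - i}"]
      simp del: atLeastAtMost_iff)
  have "card ?A = card ?T + card ({h - i + 1..h + i - 1} \<union> (\<lambda>q. n + 1 - q) ` ?U)"
    unfolding eq by (rule card_Un_disjoint) (use i fin w_cases in \<open>auto simp: n_def\<close>)
  also have "card ({h - i + 1..h + i - 1} \<union> (\<lambda>q. n + 1 - q) ` ?U)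
      = card {h - i + 1..h + i - 1} + card ((\<lambda>q. n + 1 - q) ` ?U)"
    by (rule card_Un_disjoint) (use i fin w_cases in \<open>auto simp: n_def\<close>)
  also have "card ((\<lambda>q. n + 1 - q) ` ?U) = card ?U"
    by (rule card_image) (auto simp: inj_on_def)
  finally show ?thesis using i by (simp add: hits_def)
qed

text \<open>By the half turn, rows \<open>i\<close> and \<open>n + 1 - i\<close> contain
  \<open>h\<close> equally often, so rows \<open>h + 1..n\<close> fold back onto
  \<open>1..w - 1\<close>.\<close>

lemma occurrences_A:
  assumes N: "int N = n"
  shows "int (occurrences N (ASHL N A) h) = (\<Sum>i\<in>{1..h}. hits i) + (\<Sum>i\<in>{1..w - 1}. hits i)"
proof -
  define r where "r = (\<lambda>i. int (card {j \<in> {1..n}. L i j = h}))"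
  have r_rotate: "r (h + w - i) = r i" for i
  proof -
    have "card {j \<in> {1..n}. L (n + 1 - i) j = h} = card {j \<in> {1..n}. L i j = h}"
      by (rule bij_betw_same_card[of "\<lambda>j. n + 1 - j"],
          rule bij_betw_byWitness[of _ "\<lambda>j. n + 1 - j"])
        (auto simp: L_rotate[of i "n + 1 - _", simplified] L_rotate)
    then have "r (n + 1 - i) = r i" by (simp add: r_def)
    then show ?thesis by (simp add: n_def)
  qed
  have "occurrences N (ASHL N A) h =
      card (SIGMA i:{1..N}. {j \<in> {1..N}. L (int i) (int j) = h})"
    unfolding occurrences_def ASHL_A[OF N] by (rule arg_cong[of _ _ card]) auto
  also have "\<dots> = (\<Sum>i=1..N. card {j \<in> {1..N}. L (int i) (int j) = h})"
    by (rule card_SigmaI) auto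
  also have "int \<dots> = (\<Sum>i=1..N. r (int i))"
    unfolding r_def of_nat_sum
  proof (intro sum.cong refl arg_cong[of _ _ int])
    fix i
    show "card {j \<in> {1..N}. L (int i) (int j) = h} = card {j \<in> {1..n}. L (int i) j = h}"
      by (rule bij_betw_same_card[of int], rule bij_betw_byWitness[of _ nat])
        (auto simp flip: N)
  qed
  also have "\<dots> = (\<Sum>i\<in>{1..n}. r i)"
    using sum_int_atLeastAtMost[of r N] N by simp
  also have "\<dots> = (\<Sum>i\<in>{1..h} \<union> {h + 1..n}. r i)"
    by (rule sum.cong) (use h_pos w_cases in \<open>auto simp: n_def\<close>)
  also have "\<dots> = (\<Sum>i\<in>{1..h}. r i) + (\<Sum>i\<in>{h + 1..n}. r i)"
    by (rule sum.union_disjoint) auto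
  also have "(\<Sum>i\<in>{h + 1..n}. r i) = (\<Sum>i\<in>{1..w - 1}. r i)"
    by (rule sum.reindex_bij_witness[of _ "\<lambda>i. n + 1 - i" "\<lambda>i. n + 1 - i"])
      (auto simp: r_rotate n_def)
  also have "(\<Sum>i\<in>{1..w - 1}. r i) = (\<Sum>i\<in>{1..w - 1}. hits i)"
    unfolding r_def by (rule sum.cong[OF refl], rule card_row) (use w_cases in auto)
  also have "(\<Sum>i\<in>{1..h}. r i) = (\<Sum>i\<in>{1..h}. hits i)"
    unfolding r_def by (rule sum.cong[OF refl], rule card_row) auto
  finally show ?thesis .
qed

end

section \<open>Fillings of the corners\<close>

definition single :: "int \<Rightarrow> int \<times> int \<times> int" where "single x = (x, x, x)"

lemma single_simps [simp]: "tri (single x) l = of_bool (l = x)" "alt_sum (single x) = x"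
  "wf_tri y z (single x) \<longleftrightarrow> y \<le> x \<and> x \<le> z"
  by (simp_all add: single_def)

text \<open>The adjacent corner gets the opposite triples, so row i must collect exactly one of l,
  -l when |l| \<ge> i and neither otherwise. Inner triples on the last antidiagonal have
  \<open>alt_sum\<close> 0; their -1 cancels the +1 at height 1 on the antidiagonal before. The
  height \<open>h - 2\<close> displaced there moves to the corner cell.\<close>

definition odd_tau :: "int \<Rightarrow> int \<Rightarrow> int \<Rightarrow> int \<times> int \<times> int" where
  "odd_tau h i j = (let s = i + j - 1 in
     if s = 1 then single (h - 2)
     else if s = h - 1 then if i = 1 \<or> j = 1 then single (1 - h) else (2 - h, 1, h - 1)
     else if s = h - 2 then single 1 else single s)"

text \<open>Reflection in the plane \<open>h\<close>; the order is reversed to keep heights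
  increasing.\<close>

fun opp :: "int \<times> int \<times> int \<Rightarrow> int \<times> int \<times> int" where
  "opp (a, b, c) = (-c, -b, -a)"

lemma tri_opp: "tri (opp p) l = tri p (-l)"
  by (cases p) (auto simp: of_bool_def)

lemma alt_sum_opp: "alt_sum (opp p) = - alt_sum p"
  by (cases p) auto

lemma wf_tri_opp: "wf_tri x y p \<Longrightarrow> wf_tri (-y) (-x) (opp p)"
  by (cases p) auto

lemma odd_tau_first_row:
  assumes h: "3 \<le> h"
  shows "ballot (\<lambda>q. tri (odd_tau h 1 q) l) (h - 1) (of_bool (1 \<le> l \<and> l \<le> h - 2 \<or> l = 1 - h))"
proof -
  \<comment> \<open>The column in which height \<open>l\<close> occurs; \<open>h\<close> lies beyond
    the row and means none.\<close>
  define a where "a = (if l = h - 2 then 1 else if l = 1 - h then h - 1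
     else if l = 1 then h - 2 else if 2 \<le> l \<and> l \<le> h - 3 then l else h)"
  show ?thesis
  proof (rule ballot_pair[of a "h + 1"])
    fix q assume q: "1 \<le> q" "q \<le> h - 1"
    then consider "q = 1" | "q \<noteq> 1" "q = h - 1" | "q \<noteq> 1" "q = h - 2" | "q \<noteq> 1" "q < h - 2" by linarith
    then show "tri (odd_tau h 1 q) l = of_bool (q = a) - of_bool (q = h + 1)"
      using h q by cases (auto simp: odd_tau_def a_def)
  qed (use h in \<open>auto simp: a_def\<close>)
qed

lemma odd_tau_row:
  assumes h: "3 \<le> h" and i: "2 \<le> i" "i \<le> h"
  shows "ballot (\<lambda>q. tri (odd_tau h i q) l) (h - i)
    (of_bool (i \<le> l \<and> l \<le> h - 3 \<or> i \<le> h - 2 \<and> (l = 2 - h \<or> l = h - 1) \<or> i = h - 1 \<and> l = 1 - h))"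
proof -
  \<comment> \<open>Only height 1 occurs twice: +1 on antidiagonal \<open>h - 2\<close>, then -1 on
    the last one. The values \<open>h\<close> and \<open>h + 1\<close> mean absence.\<close>
  define a where "a = (if i \<le> h - 2 \<and> (l = 2 - h \<or> l = h - 1) \<or> i = h - 1 \<and> l = 1 - h then h - i
     else if i \<le> h - 2 \<and> l = 1 then h - 1 - i else if i \<le> l \<and> l \<le> h - 3 then l - i + 1 else h)"
  define b where "b = (if i \<le> h - 2 \<and> l = 1 then h - i else h + 1)"
  show ?thesis
  proof (rule ballot_pair[of a b])
    fix q assume q: "1 \<le> q" "q \<le> h - i"
    then consider "q = h - i" "q = 1" | "q = h - i" "q \<noteq> 1" | "q = h - 1 - i" | "q < h - 1 - i" by linarith
    then show "tri (odd_tau h i q) l = of_bool (q = a) - of_bool (q = b)"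
      using h i q by cases (auto simp: odd_tau_def a_def b_def)
  qed (use h i in \<open>auto simp: a_def b_def\<close>)
qed

text \<open>In rows i \<ge> 2 an inner triple cancels the top +1 of the preceding antidiagonal and
  adds the height \<open>1 - s\<close>. Its \<open>alt_sum\<close> is 2 - s, nonzero because s \<ge>
  3 inside.\<close>

definition even_tau :: "int \<Rightarrow> int \<Rightarrow> int \<Rightarrow> int \<times> int \<times> int" where
  "even_tau h i j = (let s = i + j - 1 in
     if s = 1 then single (2 - h)
     else if i = 1 \<or> j = 1 \<or> s = h - 1 then single s else (1 - s, s - 1, s))"

text \<open>Complements \<open>even_tau\<close> row by row: each inner -1 cancels a +1 of the
  preceding antidiagonal. Inner triples have \<open>alt_sum\<close> 0 for \<open>s = h - 1\<close>
  and \<open>s = h\<close>, and s - 2 otherwise.\<close>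

definition even_mu :: "int \<Rightarrow> int \<Rightarrow> int \<Rightarrow> int \<times> int \<times> int" where
  "even_mu h i j = (let s = i + j - 1 in
     if s = 1 then single (1 - h)
     else if s = h then if i = 1 \<or> j = 1 then single h else (1 - h, 1, h)
     else if i = 1 \<or> j = 1 then if s = h - 1 then single 1 else single (1 - s)
     else (1 - s, 2 - s, if s = h - 1 then 1 else s - 1))"

lemma even_tau_first_row:
  assumes h: "3 \<le> h"
  shows "ballot (\<lambda>q. tri (even_tau h 1 q) l) (h - 1) (of_bool (2 \<le> l \<and> l \<le> h - 1 \<or> l = 2 - h))"
proof -
  define a where "a = (if l = 2 - h then 1 else if 2 \<le> l \<and> l \<le> h - 1 then l else h)"
  show ?thesis
    by (rule ballot_pair[of a "h + 1"]) (use h in \<open>auto simp: a_def even_tau_def\<close>)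
qed

lemma even_mu_first_row:
  assumes h: "3 \<le> h"
  shows "ballot (\<lambda>q. tri (even_mu h 1 q) l) h
    (of_bool (3 - h \<le> l \<and> l \<le> -1 \<or> l = 1 - h \<or> l = 1 \<or> l = h))"
proof -
  define a where "a = (if l = 1 - h then 1 else if l = 1 then h - 1 else if l = h then h
    else if 3 - h \<le> l \<and> l \<le> -1 then 1 - l else h + 1)"
  show ?thesis
  proof (rule ballot_pair[of a "h + 2"])
    fix q assume q: "1 \<le> q" "q \<le> h"
    then consider "q = 1" | "q \<noteq> 1" "q = h" | "q \<noteq> 1" "q = h - 1" | "q \<noteq> 1" "q < h - 1" by linarith
    then show "tri (even_mu h 1 q) l = of_bool (q = a) - of_bool (q = h + 2)"
      using h q by cases (auto simp: even_mu_def a_def)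
  qed (use h in \<open>auto simp: a_def\<close>)
qed

lemma even_tau_row:
  assumes h: "3 \<le> h" and i: "2 \<le> i" "i \<le> h"
  shows "ballot (\<lambda>q. tri (even_tau h i q) l) (h - i)
    (of_bool (i \<le> l \<and> (l = h - 2 \<or> l = h - 1) \<or> i \<le> -l \<and> -l \<le> h - 3))"
proof -
  \<comment> \<open>Heights \<open>i \<le> l \<le> h - 3\<close> are cancelled in the next
    column.\<close>
  define a where "a = (if i \<le> l \<and> l \<le> h - 1 then l - i + 1
     else if i \<le> -l \<and> -l \<le> h - 3 then 2 - l - i else h)"
  define b where "b = (if i \<le> l \<and> l \<le> h - 3 then l - i + 2 else h + 1)"
  show ?thesis
  proof (rule ballot_pair[of a b])
    fix q assume q: "1 \<le> q" "q \<le> h - i"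
    then consider "q = h - i" | "q \<noteq> h - i" "q = 1" | "q \<noteq> h - i" "q \<noteq> 1" by linarith
    then show "tri (even_tau h i q) l = of_bool (q = a) - of_bool (q = b)"
      using h i q by cases (auto simp: even_tau_def a_def b_def)
  qed (use h i in \<open>auto simp: a_def b_def\<close>)
qed

lemma even_mu_row:
  assumes h: "3 \<le> h" and i: "2 \<le> i" "i \<le> h"
  shows "ballot (\<lambda>q. tri (even_mu h i q) l) (h + 1 - i)
    (of_bool (i \<le> -l \<and> (l = 2 - h \<or> l = 1 - h) \<or> i \<le> l \<and> l \<le> h - 3 \<or> l = h))"
proof -
  \<comment> \<open>Height 1 and the heights -(i - 1) down to -(h - 3) are cancelled in the next
    column; \<open>h + 1\<close> and \<open>h + 2\<close> mean absence.\<close>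
  define a where "a = (if l = h then h + 1 - i else if l = 1 \<and> i \<le> h - 1 then h - i
     else if i \<le> l \<and> l \<le> h - 3 then l + 2 - i
     else if i - 1 \<le> -l \<and> -l \<le> h - 3 \<or> i \<le> -l \<and> -l \<le> h - 1 then 2 - l - i else h + 1)"
  define b where "b = (if l = 1 \<and> i \<le> h - 1 then h + 1 - i
     else if i - 1 \<le> -l \<and> -l \<le> h - 3 then 3 - l - i else h + 2)"
  show ?thesis
  proof (rule ballot_pair[of a b])
    fix q assume q: "1 \<le> q" "q \<le> h + 1 - i"
    then consider "q = h + 1 - i" "q = 1" | "q = h + 1 - i" "q \<noteq> 1" | "q = h - i" "q = 1"
      | "q = h - i" "q \<noteq> 1" | "q < h - i" "q = 1" | "q < h - i" "q \<noteq> 1" by linarith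
    then show "tri (even_mu h i q) l = of_bool (q = a) - of_bool (q = b)"
      using h i q by cases (auto simp: even_mu_def a_def b_def)
  qed (use h i in \<open>auto simp: a_def b_def\<close>)
qed

section \<open>Verifying the fillings and counting\<close>

lemma sum_odds:
  fixes m :: int
  assumes "0 \<le> m"
  shows "(\<Sum>i\<in>{1..m}. 2 * i - 1) = m ^ 2"
  using assms
proof (induction m rule: int_ge_induct)
  case (step m)
  have "{1..m + 1} = insert (m + 1) {1..m}" using step by auto
  then show ?case using step by (simp add: power2_eq_square algebra_simps)
qed simp

lemma sum_of_bool_interval:
  fixes c m :: int
  assumes "1 \<le> c" "c \<le> m"
  shows "(\<Sum>i\<in>{1..m}. of_bool (2 \<le> i \<and> i \<le> c)) = c - 1"
proof -
  have "{1..m} \<inter> {i. 2 \<le> i \<and> i \<le> c} = {2..c}" using assms by auto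
  then show ?thesis using assms by (simp add: sum_of_bool_eq)
qed

lemma odd_tau_sym: "odd_tau h i j = odd_tau h j i"
  unfolding odd_tau_def add.commute[of j i] disj_commute[of "j = 1" "i = 1"] ..

lemma even_tau_sym: "even_tau h i j = even_tau h j i"
  unfolding even_tau_def add.commute[of j i] disj_left_commute[of "j = 1" "i = 1"] ..

lemma even_mu_sym: "even_mu h i j = even_mu h j i"
  unfolding even_mu_def add.commute[of j i] disj_commute[of "j = 1" "i = 1"] ..

lemma corner_filling_odd:
  assumes h: "3 \<le> h"
  shows "corner_filling h h (odd_tau h) (\<lambda>i j. opp (odd_tau h i j))"
proof
  have wf: "wf_tri (1 - h) (h - 1) (odd_tau h i j)" if "1 \<le> i" "1 \<le> j" "i + j \<le> h" for i j
    using that h by (auto simp: odd_tau_def Let_def)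
  then show "wf_tri (1 - h) (h - 1) (odd_tau h i j)" if "1 \<le> i" "1 \<le> j" "i + j \<le> h" for i j
    using that by blast
  show "wf_tri (1 - h) (h - 1) (opp (odd_tau h i j))" if "1 \<le> i" "1 \<le> j" "i + j \<le> h" for i j
    using wf_tri_opp[OF wf[OF that]] by simp
  fix i l :: int assume i: "1 \<le> i" "i \<le> h" and l: "1 - h \<le> l" "l \<le> h - 1"
  show "\<exists>t u. ballot (\<lambda>q. tri (odd_tau h i q) l) (h - i) t \<and>
      ballot (\<lambda>q. tri (opp (odd_tau h i q)) l) (h - i) u \<and> t + u = of_bool (i \<le> \<bar>l\<bar>)"
  proof (cases "i = 1")
    case True
    show ?thesis unfolding True tri_opp
      by (intro exI conjI) (rule odd_tau_first_row[OF h], rule odd_tau_first_row[OF h], use h l in auto)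
  next
    case False
    then have i: "2 \<le> i" "i \<le> h" using i by auto
    show ?thesis unfolding tri_opp
      by (intro exI conjI) (rule odd_tau_row[OF h i], rule odd_tau_row[OF h i], use h i l in auto)
  qed
qed (use h odd_tau_sym in auto)

text \<open>In each row the levels l with |l| \<ge> i are split between the two corners without
  overlap.\<close>

lemma corner_filling_even:
  assumes h: "3 \<le> h"
  shows "corner_filling h (h + 1) (even_tau h) (even_mu h)"
proof
  show "wf_tri (1 - h) (h + 1 - 1) (even_tau h i j)" if "1 \<le> i" "1 \<le> j" "i + j \<le> h" for i j
    using that h by (auto simp: even_tau_def Let_def)
  show "wf_tri (1 - h) (h + 1 - 1) (even_mu h i j)" if "1 \<le> i" "1 \<le> j" "i + j \<le> h + 1" for i j
    using that h by (auto simp: even_mu_def Let_def)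
  fix i l :: int assume i: "1 \<le> i" "i \<le> h" and l: "1 - h \<le> l" "l \<le> h + 1 - 1"
  show "\<exists>t u. ballot (\<lambda>q. tri (even_tau h i q) l) (h - i) t \<and>
      ballot (\<lambda>q. tri (even_mu h i q) l) (h + 1 - i) u \<and> t + u = of_bool (i \<le> \<bar>l\<bar>)"
  proof (cases "i = 1")
    case True
    have *: "h + 1 - 1 = h" by simp
    show ?thesis unfolding True *
      by (intro exI conjI) (rule even_tau_first_row[OF h], rule even_mu_first_row[OF h], use h l in auto)
  next
    case False
    then have i: "2 \<le> i" "i \<le> h" using i by auto
    show ?thesis
      by (intro exI conjI) (rule even_tau_row[OF h i], rule even_mu_row[OF h i], use h i l in auto)
  qed
qed (use h even_tau_sym even_mu_sym in auto)

lemma exists_ASHM_odd: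
  assumes "odd N" "5 \<le> N"
  shows "\<exists>A. ASHM N A \<and>
    int (occurrences N (ASHL N A) (int ((N + 1) div 2))) = (int N ^ 2 + 4 * int N - 19) div 2"
proof -
  define h where "h = int ((N + 1) div 2)"
  have h: "3 \<le> h" and N: "int N = 2 * h - 1" using assms unfolding h_def by presburger+
  interpret corner_filling h h "odd_tau h" "\<lambda>i j. opp (odd_tau h i j)"
    by (rule corner_filling_odd[OF h])
  have n: "int N = n" by (simp add: n_def N)
  have hits: "hits i = 2 * i - 1 + 2 * of_bool (2 \<le> i \<and> i \<le> h - 2)" if "1 \<le> i" "i \<le> h" for i
  proof -
    \<comment> \<open>The zeros are the inner cells of the last antidiagonal; \<open>opp\<close> has
      the same zeros, whence the factor 2.\<close>
    have "{q \<in> {1..h - i}. alt_sum (odd_tau h i q) = 0} = (if 2 \<le> i \<and> i \<le> h - 2 then {h - i} else {})"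
      using that h by (auto simp: odd_tau_def Let_def split: if_splits)
    then show ?thesis by (simp add: hits_def alt_sum_opp)
  qed
  have sum: "(\<Sum>i\<in>{1..m}. hits i) = m ^ 2 + 2 * (h - 3)" if "h - 1 \<le> m" "m \<le> h" for m
  proof -
    have "(\<Sum>i\<in>{1..m}. hits i) = (\<Sum>i\<in>{1..m}. 2 * i - 1 + 2 * of_bool (2 \<le> i \<and> i \<le> h - 2))"
      using that by (intro sum.cong refl hits) auto
    also have "\<dots> = m ^ 2 + 2 * (h - 3)"
      unfolding sum.distrib sum_distrib_left[symmetric]
      using that h sum_odds[of m] sum_of_bool_interval[of "h - 2" m] by simp
    finally show ?thesis .
  qed
  \<comment> \<open>The total is \<open>h ^ 2 + (h - 1) ^ 2 + 4 * (h - 3)\<close>.\<close>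
  have "int (occurrences N (ASHL N A) h) = (int N ^ 2 + 4 * int N - 19) div 2"
    using sum[of h] sum[of "h - 1"] h
    unfolding occurrences_A[OF n] N by (simp add: power2_eq_square algebra_simps)
  then show ?thesis using ASHM_A[OF n] unfolding h_def[symmetric] by blast
qed

lemma exists_ASHM_even:
  assumes "even N" "6 \<le> N"
  shows "\<exists>A. ASHM N A \<and>
    int (occurrences N (ASHL N A) (int (N div 2))) = (int N ^ 2 + 4 * int N - 20) div 2"
proof -
  define h where "h = int (N div 2)"
  have h: "3 \<le> h" and N: "int N = 2 * h" using assms unfolding h_def by presburger+
  interpret corner_filling h "h + 1" "even_tau h" "even_mu h"
    by (rule corner_filling_even[OF h])
  have n: "int N = n" by (simp add: n_def N)
  have hits: "hits i = 2 * i - 1 + of_bool (2 \<le> i \<and> i \<le> h - 2) + of_bool (2 \<le> i \<and> i \<le> h - 1)"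
    if "1 \<le> i" "i \<le> h" for i
  proof -
    have no_tau: "{q \<in> {1..h - i}. alt_sum (even_tau h i q) = 0} = {}"
      using that h by (auto simp: even_tau_def Let_def split: if_splits)
    \<comment> \<open>Inner cells of antidiagonals \<open>h - 1\<close> and \<open>h\<close>,
      respectively.\<close>
    have mu: "{q \<in> {1..h + 1 - i}. alt_sum (even_mu h i q) = 0} =
        (if 2 \<le> i \<and> i \<le> h - 2 then {h - i} else {}) \<union> (if 2 \<le> i \<and> i \<le> h - 1 then {h + 1 - i} else {})"
      using that h by (auto simp: even_mu_def Let_def split: if_splits)
    show ?thesis unfolding hits_def no_tau mu by simp
  qed
  have "(\<Sum>i\<in>{1..h}. hits i) =
      (\<Sum>i\<in>{1..h}. 2 * i - 1 + of_bool (2 \<le> i \<and> i \<le> h - 2) + of_bool (2 \<le> i \<and> i \<le> h - 1))"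
    by (intro sum.cong refl hits) auto
  also have "\<dots> = h ^ 2 + (2 * h - 5)"
    unfolding sum.distrib
    using h sum_odds[of h] sum_of_bool_interval[of "h - 2" h] sum_of_bool_interval[of "h - 1" h] by simp
  \<comment> \<open>Both halves have \<open>h\<close> rows here, so this sum counts twice.\<close>
  finally have "int (occurrences N (ASHL N A) h) = (int N ^ 2 + 4 * int N - 20) div 2"
    unfolding occurrences_A[OF n] N by (simp add: power2_eq_square algebra_simps)
  then show ?thesis using ASHM_A[OF n] unfolding h_def[symmetric] by blast
qed

section \<open>Order 4\<close>

definition tetrahedron :: "nat \<Rightarrow> nat \<Rightarrow> nat \<Rightarrow> int" where
  "tetrahedron i j k = (if k < i + j \<and> i < j + k \<and> j < i + k \<and> i + j + k \<le> 9
     then if odd (i + j + k) then 1 else -1 else 0)"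

text \<open>Invariance under permuting coordinates leaves one direction to check, where each line is
  an alternating block.\<close>

lemma ASHM_tetrahedron: "ASHM 4 tetrahedron"
proof -
  have line: "alt_sign_line (map (tetrahedron i j) [1..<4 + 1])"
    if "i \<in> {1..4}" "j \<in> {1..4}" for i j
  proof -
    define f where "f = (\<lambda>k. tetrahedron i j (nat k))"
    \<comment> \<open>The inequalities of the tetrahedron solved for the third coordinate.\<close>
    define a b where "a = \<bar>int i - int j\<bar> + 1" and "b = min (int i + int j - 1) (9 - int i - int j)"
    have "ballot f (int 4) 1"
    proof (rule ballot_checkerboard[of a b])
      have "b = int i + int j - 1 \<or> b = 9 - int i - int j"
        and a: "a = int i - int j + 1 \<or> a = int j - int i + 1"
        unfolding a_def b_def by linarith+
      then show "even (b - a)" by (elim disjE) simp_all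
      fix k :: int assume k: "1 \<le> k" "k \<le> int 4"
      then obtain m where m: "k = int m" by (metis nonneg_int_cases order_trans zero_le_one)
      have "even (k - a) \<longleftrightarrow> odd (i + j + m)" using a unfolding m by (elim disjE) auto
      moreover have "a \<le> k \<and> k \<le> b \<longleftrightarrow> m < i + j \<and> i < j + m \<and> j < i + m \<and> i + j + m \<le> 9"
        unfolding a_def b_def m by linarith
      ultimately show "f k = (if a \<le> k \<and> k \<le> b then if even (k - a) then 1 else -1 else 0)"
        by (simp add: f_def tetrahedron_def m)
    qed (use that in \<open>auto simp: a_def b_def\<close>)
    then show ?thesis using alt_sign_line_ballot by (fastforce simp: f_def)
  qed
  have sym: "tetrahedron i j k = tetrahedron j k i" "tetrahedron i j k = tetrahedron i k j" for i j k
    by (auto simp: tetrahedron_def add.commute add.left_commute)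
  have "alt_sign_line (map (\<lambda>i. tetrahedron i j k) [1..<4 + 1])"
    if "j \<in> {1..4}" "k \<in> {1..4}" for j k
    using line[OF that] by (subst sym(1))
  moreover have "alt_sign_line (map (\<lambda>j. tetrahedron i j k) [1..<4 + 1])"
    if "i \<in> {1..4}" "k \<in> {1..4}" for i k
    using line[OF that] by (subst sym(2))
  moreover have "tetrahedron i j k \<in> {0, 1, -1}" for i j k
    by (simp add: tetrahedron_def)
  ultimately show ?thesis unfolding ASHM_def using line by blast
qed

lemma occurrences_tetrahedron: "occurrences 4 (ASHL 4 tetrahedron) 2 = 6"
proof -
  let ?S = "{(1, 2), (2, 1), (2, 2), (3, 3), (3, 4), (4, 3)} :: (nat \<times> nat) set"
  have r: "{1..4::nat} = {1, 2, 3, 4}" by auto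
  have "ASHL 4 tetrahedron i j = 2 \<longleftrightarrow> (i, j) \<in> ?S" if "i \<in> {1..4}" "j \<in> {1..4}" for i j
    using that unfolding r ASHL_def plane_def
    by (elim insertE emptyE; simp add: tetrahedron_def)
  then have "{(i, j). i \<in> {1..4} \<and> j \<in> {1..4} \<and> ASHL 4 tetrahedron i j = 2} =
      {(i, j). i \<in> {1..4} \<and> j \<in> {1..4} \<and> (i, j) \<in> ?S}"
    by blast
  also have "\<dots> = ?S" by auto
  finally show ?thesis by (simp add: occurrences_def)
qed

theorem theorem3p4:
  fixes n :: nat
  assumes "n \<ge> 4"
  shows "\<exists>A. ASHM n A \<and>
    (odd n \<longrightarrow> int (occurrences n (ASHL n A) (int ((n + 1) div 2)))
                  = (int n ^ 2 + 4 * int n - 19) div 2) \<and>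
    (even n \<longrightarrow> int (occurrences n (ASHL n A) (int (n div 2)))
                  = (int n ^ 2 + 4 * int n - 20) div 2)"
proof (cases "odd n")
  case True
  then have "5 \<le> n" using assms by presburger
  then show ?thesis using exists_ASHM_odd[OF True] True by blast
next
  case even: False
  show ?thesis
  proof (cases "n = 4")
    case True
    then show ?thesis using ASHM_tetrahedron occurrences_tetrahedron by (intro exI[of _ tetrahedron]) simp
  next
    case False
    then have "6 \<le> n" using assms even by presburger
    then show ?thesis using exists_ASHM_even[of n] even by blast
  qed
qed

end
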